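(* Let $w=(w_j)$ be a positive non-increasing sequence with $w_1=1$, $\lim_{j\to\infty}w_j=0$ and $\sum_{j=1}^\infty w_j=\infty$. Then the Azimi-Hagler space $X(w)$ does not have the W.A.P.
   Context: $X(w)$ is the Banach space of scalar sequences $x=(x_j)$ for which $$\|x\|=\sup\sum_{j=1}^n w_j\Big|\sum_{k\in F_j}x_k\Big|<\infty,$$ where the supremum is over all $n\in\mathbb N$ and all finite intervals $F_1<\dots<F_n$ of $\mathbb N$ (i.e. $\max F_i<\min F_{i+1}$). A Banach space $E$ has the weakly compact approximation property (W.A.P.) if there is a constant $C<\infty$ such that for every weakly compact set $D\subset E$ and every $\varepsilon>0$ there is a weakly compact operator $V:E\to E$ with $\sup_{x\in D}\|x-Vx\|<\varepsilon$ and $\|V\|\le C$. *)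

theory Defs
  imports "HOL-Analysis.Analysis" "HOL-Library.Function_Algebras"
begin

text \<open>
  A normed space over \<open>'k\<close> is given by a scalar multiplication \<open>s\<close> on an ambient type, a carrier
  subspace \<open>E\<close> and a norm \<open>N\<close>, of which only the values on \<open>E\<close> matter.  A carrier is needed
  because \<open>X(w)\<close> depends on the sequence \<open>w\<close> and so cannot be a type.

  The sort \<open>{real_normed_field, euclidean_space}\<close> for \<open>'k\<close> covers real and complex scalars at
  once: up to isometric isomorphism, the reals and the complex numbers are its only instances.
\<close>

locale banach_space_on = vector_space s
  for s :: "'k::real_normed_field \<Rightarrow> 'v::ab_group_add \<Rightarrow> 'v" +
  fixes E :: "'v set" and N :: "'v \<Rightarrow> real"
  assumes subspace_carrier: "subspace E"
    and norm_nonneg: "x \<in> E \<Longrightarrow> 0 \<le> N x"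
    and norm_eq_zero: "x \<in> E \<Longrightarrow> N x = 0 \<longleftrightarrow> x = 0"
    and norm_scale: "x \<in> E \<Longrightarrow> N (s c x) = norm c * N x"
    and norm_triangle: "x \<in> E \<Longrightarrow> y \<in> E \<Longrightarrow> N (x + y) \<le> N x + N y"
    and complete: "(\<And>n. X n \<in> E) \<Longrightarrow> (\<And>e. 0 < e \<Longrightarrow> \<exists>M. \<forall>m\<ge>M. \<forall>n\<ge>M. N (X m - X n) < e) \<Longrightarrow>
          \<exists>x\<in>E. (\<lambda>n. N (X n - x)) \<longlonglongrightarrow> 0"

definition bounded_functional ::
  "('k::real_normed_field \<Rightarrow> 'v::ab_group_add \<Rightarrow> 'v) \<Rightarrow> 'v set \<Rightarrow> ('v \<Rightarrow> real) \<Rightarrow> ('v \<Rightarrow> 'k) \<Rightarrow> bool"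
where
  "bounded_functional s E N f \<longleftrightarrow>
     (\<forall>x\<in>E. \<forall>y\<in>E. f (x + y) = f x + f y) \<and>
     (\<forall>c. \<forall>x\<in>E. f (s c x) = c * f x) \<and>
     (\<exists>K. \<forall>x\<in>E. norm (f x) \<le> K * N x)"

definition weak_topology ::
  "('k::real_normed_field \<Rightarrow> 'v::ab_group_add \<Rightarrow> 'v) \<Rightarrow> 'v set \<Rightarrow> ('v \<Rightarrow> real) \<Rightarrow> 'v topology"
where
  "weak_topology s E N =
     topology_generated_by {{x \<in> E. f x \<in> U} | f U. bounded_functional s E N f \<and> open U}"

definition bounded_operator ::
  "('k::real_normed_field \<Rightarrow> 'v::ab_group_add \<Rightarrow> 'v) \<Rightarrow> 'v set \<Rightarrow> ('v \<Rightarrow> real) \<Rightarrow> ('v \<Rightarrow> 'v) \<Rightarrow> bool"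
where
  "bounded_operator s E N V \<longleftrightarrow>
     (\<forall>x\<in>E. V x \<in> E) \<and>
     (\<forall>x\<in>E. \<forall>y\<in>E. V (x + y) = V x + V y) \<and>
     (\<forall>c. \<forall>x\<in>E. V (s c x) = s c (V x)) \<and>
     (\<exists>K. \<forall>x\<in>E. N (V x) \<le> K * N x)"

definition operator_norm :: "'v set \<Rightarrow> ('v \<Rightarrow> real) \<Rightarrow> ('v \<Rightarrow> 'v) \<Rightarrow> real" where
  "operator_norm E N V = (SUP x\<in>{x \<in> E. N x \<le> 1}. N (V x))"

definition weakly_compact_operator ::
  "('k::real_normed_field \<Rightarrow> 'v::ab_group_add \<Rightarrow> 'v) \<Rightarrow> 'v set \<Rightarrow> ('v \<Rightarrow> real) \<Rightarrow> ('v \<Rightarrow> 'v) \<Rightarrow> bool"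
where
  "weakly_compact_operator s E N V \<longleftrightarrow>
     bounded_operator s E N V \<and>
     compactin (weak_topology s E N) (weak_topology s E N closure_of (V ` {x \<in> E. N x \<le> 1}))"

text \<open>
  The first supremum is taken in \<^typ>\<open>ereal\<close>, so that it is \<open>-\<infinity>\<close>, hence below \<open>\<epsilon>\<close>,
  for the weakly compact set \<open>D = {}\<close>.
\<close>

definition has_WAP ::
  "('k::real_normed_field \<Rightarrow> 'v::ab_group_add \<Rightarrow> 'v) \<Rightarrow> 'v set \<Rightarrow> ('v \<Rightarrow> real) \<Rightarrow> bool"
where
  "has_WAP s E N \<longleftrightarrow>
     (\<exists>C. \<forall>D. compactin (weak_topology s E N) D \<longrightarrow>
       (\<forall>\<epsilon>>0. \<exists>V. weakly_compact_operator s E N V \<and>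
          (SUP x\<in>D. ereal (N (x - V x))) < ereal \<epsilon> \<and>
          operator_norm E N V \<le> C))"

text \<open>
  Both the weights and the sequences are indexed from \<open>0\<close>: \<open>w j\<close> and \<open>x j\<close> stand for
  \<open>w\<^sub>j\<^sub>+\<^sub>1\<close> and \<open>x\<^sub>j\<^sub>+\<^sub>1\<close>.  The interval \<open>F\<^sub>j\<close> is \<open>{a j..b j}\<close>.
\<close>

definition seq_scale :: "'k::real_normed_field \<Rightarrow> (nat \<Rightarrow> 'k) \<Rightarrow> nat \<Rightarrow> 'k" where
  "seq_scale c x = (\<lambda>j. c * x j)"

definition AH_sums :: "(nat \<Rightarrow> real) \<Rightarrow> (nat \<Rightarrow> 'k::real_normed_field) \<Rightarrow> real set" where
  "AH_sums w x =
     {(\<Sum>j<n. w j * norm (\<Sum>k\<in>{a j..b j}. x k)) | n a b.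
        (\<forall>j<n. a j \<le> b j) \<and> (\<forall>j. Suc j < n \<longrightarrow> b j < a (Suc j))}"

definition AH_space :: "(nat \<Rightarrow> real) \<Rightarrow> (nat \<Rightarrow> 'k::real_normed_field) set" where
  "AH_space w = {x. bdd_above (AH_sums w x)}"

definition AH_norm :: "(nat \<Rightarrow> real) \<Rightarrow> (nat \<Rightarrow> 'k::real_normed_field) \<Rightarrow> real" where
  "AH_norm w x = Sup (AH_sums w x)"

lemma AH_sum_le:
  assumes "x \<in> AH_space w" "\<forall>j<n. a j \<le> b j" "\<forall>j. Suc j < n \<longrightarrow> b j < a (Suc j)"
  shows "(\<Sum>j<n. w j * norm (\<Sum>k\<in>{a j..b j}. x k)) \<le> AH_norm w x"
  unfolding AH_norm_def
  by (rule cSup_upper) (use assms in \<open>auto simp: AH_sums_def AH_space_def\<close>)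

lemma AH_normI:
  fixes x :: "nat \<Rightarrow> 'k::real_normed_field"
  assumes "\<And>n a b. \<forall>j<n. a j \<le> b j \<Longrightarrow> \<forall>j. Suc j < n \<longrightarrow> b j < a (Suc j) \<Longrightarrow>
             (\<Sum>j<n. w j * norm (\<Sum>k\<in>{a j..b j}. x k)) \<le> M"
  shows "x \<in> AH_space w" "AH_norm w x \<le> M"
proof -
  have le: "y \<le> M" if "y \<in> AH_sums w x" for y
    using that assms by (auto simp: AH_sums_def)
  have "(\<Sum>j<0. w j * norm (\<Sum>k\<in>{j..j}. x k)) \<in> AH_sums w x"
    unfolding AH_sums_def by fastforce
  then have "AH_sums w x \<noteq> {}" by blast
  with le show "AH_norm w x \<le> M" unfolding AH_norm_def by (meson cSup_least)
  show "x \<in> AH_space w" unfolding AH_space_def using le by (auto simp: bdd_above_def)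
qed

lemma AH_coord_le:
  assumes "x \<in> AH_space w" "w 0 = 1"
  shows "norm (x k) \<le> AH_norm w x"
  using AH_sum_le[OF assms(1), of 1 "\<lambda>_. k" "\<lambda>_. k"] assms(2) by simp

lemma AH_space_banach:
  fixes w :: "nat \<Rightarrow> real"
  assumes pos: "\<And>j. 0 < w j" and w0: "w 0 = 1"
  shows "banach_space_on (seq_scale :: 'k::{real_normed_field,euclidean_space} \<Rightarrow> _)
           (AH_space w) (AH_norm w)"
proof -
  let ?X = "AH_space w :: (nat \<Rightarrow> 'k) set"
  let ?N = "AH_norm w :: (nat \<Rightarrow> 'k) \<Rightarrow> real"
  interpret vector_space "seq_scale :: 'k \<Rightarrow> _"
    by unfold_locales (auto simp: seq_scale_def fun_eq_iff algebra_simps)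
  have zero: "0 \<in> ?X" "?N 0 \<le> 0"
    by (rule AH_normI[where M = 0]; simp)+
  have nonneg: "0 \<le> ?N x" if "x \<in> ?X" for x
    using AH_sum_le[OF that, of 0] by simp
  have add: "x + y \<in> ?X" "?N (x + y) \<le> ?N x + ?N y" if x: "x \<in> ?X" and y: "y \<in> ?X" for x y
  proof -
    have "(\<Sum>j<n. w j * norm (\<Sum>k\<in>{a j..b j}. (x + y) k)) \<le> ?N x + ?N y"
      if "\<forall>j<n. a j \<le> b j" "\<forall>j. Suc j < n \<longrightarrow> b j < a (Suc j)" for n a b
    proof -
      have "(\<Sum>j<n. w j * norm (\<Sum>k\<in>{a j..b j}. (x + y) k)) \<le>
        (\<Sum>j<n. w j * norm (\<Sum>k\<in>{a j..b j}. x k) + w j * norm (\<Sum>k\<in>{a j..b j}. y k))"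
        unfolding plus_fun_apply sum.distrib distrib_left[symmetric]
        by (intro sum_mono mult_left_mono norm_triangle_ineq less_imp_le[OF pos])
      also have "\<dots> \<le> ?N x + ?N y"
        unfolding sum.distrib by (intro add_mono AH_sum_le x y that)
      finally show ?thesis .
    qed
    from AH_normI[of w "x + y", OF this] show "x + y \<in> ?X" "?N (x + y) \<le> ?N x + ?N y" by blast+
  qed
  have scl: "seq_scale c x \<in> ?X" "?N (seq_scale c x) \<le> norm c * ?N x" if x: "x \<in> ?X" for c x
  proof -
    have "(\<Sum>j<n. w j * norm (\<Sum>k\<in>{a j..b j}. seq_scale c x k)) \<le> norm c * ?N x"
      if "\<forall>j<n. a j \<le> b j" "\<forall>j. Suc j < n \<longrightarrow> b j < a (Suc j)" for n a b
    proof -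
      have "(\<Sum>j<n. w j * norm (\<Sum>k\<in>{a j..b j}. seq_scale c x k)) =
        norm c * (\<Sum>j<n. w j * norm (\<Sum>k\<in>{a j..b j}. x k))"
        by (simp add: seq_scale_def sum_distrib_left[symmetric] norm_mult algebra_simps)
      also have "\<dots> \<le> norm c * ?N x"
        by (intro mult_left_mono AH_sum_le x that) auto
      finally show ?thesis .
    qed
    from AH_normI[of w "seq_scale c x", OF this]
    show "seq_scale c x \<in> ?X" "?N (seq_scale c x) \<le> norm c * ?N x" by blast+
  qed
  have scl_eq: "?N (seq_scale c x) = norm c * ?N x" if x: "x \<in> ?X" for c x
  proof (cases "c = 0")
    case True
    then have "seq_scale c x = 0" by (simp add: seq_scale_def fun_eq_iff)
    with True zero nonneg show ?thesis by (simp add: antisym)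
  next
    case False
    then have "x = seq_scale (inverse c) (seq_scale c x)"
      by (simp add: seq_scale_def fun_eq_iff)
    then have "?N x \<le> norm (inverse c) * ?N (seq_scale c x)"
      using scl(2)[OF scl(1)[OF x]] by metis
    then have "norm c * ?N x \<le> norm c * (norm (inverse c) * ?N (seq_scale c x))"
      by (rule mult_left_mono) simp
    also have "\<dots> = norm (c * inverse c) * ?N (seq_scale c x)"
      by (simp only: norm_mult mult.assoc)
    finally have "norm c * ?N x \<le> ?N (seq_scale c x)"
      using False by simp
    with scl(2)[OF x] show ?thesis by (simp add: antisym)
  qed
  have sub: "subspace ?X"
    unfolding subspace_def using zero add scl by blast
  have zero_iff: "?N x = 0 \<longleftrightarrow> x = 0" if "x \<in> ?X" for x
  proof
    assume "?N x = 0"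
    with AH_coord_le[OF that w0] have "norm (x k) \<le> 0" for k by metis
    then show "x = 0" by (simp add: fun_eq_iff)
  next
    assume "x = 0"
    with zero nonneg show "?N x = 0" by (simp add: antisym)
  qed
  have diff: "x - y \<in> ?X" if "x \<in> ?X" "y \<in> ?X" for x y
    using subspace_diff[OF sub] that by blast
  have compl: "\<exists>x\<in>?X. (\<lambda>n. ?N (X n - x)) \<longlonglongrightarrow> 0"
    if X: "\<And>n. X n \<in> ?X" and Cau: "\<And>e. 0 < e \<Longrightarrow> \<exists>M. \<forall>m\<ge>M. \<forall>n\<ge>M. ?N (X m - X n) < e"
    for X
  proof -
    have "Cauchy (\<lambda>n. X n k)" for k
    proof (rule CauchyI)
      fix e :: real assume "0 < e"
      then obtain M where M: "\<forall>m\<ge>M. \<forall>n\<ge>M. ?N (X m - X n) < e" using Cau by blast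
      have "norm (X m k - X n k) < e" if "M \<le> m" "M \<le> n" for m n
      proof -
        have "norm (X m k - X n k) \<le> ?N (X m - X n)"
          using AH_coord_le[OF diff[OF X X] w0, of m n k] by simp
        also have "\<dots> < e" using M that by blast
        finally show ?thesis .
      qed
      then show "\<exists>M. \<forall>m\<ge>M. \<forall>n\<ge>M. norm (X m k - X n k) < e" by blast
    qed
    then have "\<exists>l. (\<lambda>n. X n k) \<longlonglongrightarrow> l" for k
      using Cauchy_convergent convergent_def by blast
    then obtain x where x: "\<And>k. (\<lambda>n. X n k) \<longlonglongrightarrow> x k" by metis
    have tail: "\<exists>M. \<forall>m\<ge>M. X m - x \<in> ?X \<and> ?N (X m - x) \<le> e" if e: "0 < e" for e
    proof -
      obtain M where M: "\<And>m n. M \<le> m \<Longrightarrow> M \<le> n \<Longrightarrow> ?N (X m - X n) < e"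
        using Cau[OF e] by blast
      have "X m - x \<in> ?X \<and> ?N (X m - x) \<le> e" if m: "M \<le> m" for m
      proof -
        have "(\<Sum>j<n. w j * norm (\<Sum>k\<in>{a j..b j}. (X m - x) k)) \<le> e"
          if ab: "\<forall>j<n. a j \<le> b j" "\<forall>j. Suc j < n \<longrightarrow> b j < a (Suc j)" for n a b
        proof (rule LIMSEQ_le_const2)
          show "(\<lambda>i. \<Sum>j<n. w j * norm (\<Sum>k\<in>{a j..b j}. (X m - X i) k))
            \<longlonglongrightarrow> (\<Sum>j<n. w j * norm (\<Sum>k\<in>{a j..b j}. (X m - x) k))"
            unfolding fun_diff_def by (intro tendsto_intros x)
          have "(\<Sum>j<n. w j * norm (\<Sum>k\<in>{a j..b j}. (X m - X i) k)) \<le> e" if "M \<le> i" for i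
            using AH_sum_le[OF diff[OF X X] ab, of m i] M[OF m that] by linarith
          then show "\<exists>M. \<forall>i\<ge>M. (\<Sum>j<n. w j * norm (\<Sum>k\<in>{a j..b j}. (X m - X i) k)) \<le> e"
            by blast
        qed
        from AH_normI[of w "X m - x", OF this] show ?thesis by blast
      qed
      then show ?thesis by blast
    qed
    obtain M where "X M - x \<in> ?X" using tail[of 1] by auto
    from diff[OF X[of M] this] have xX: "x \<in> ?X" by simp
    have "(\<lambda>n. ?N (X n - x)) \<longlonglongrightarrow> 0"
    proof (rule LIMSEQ_I)
      fix r :: real assume "0 < r"
      then obtain M where "\<forall>m\<ge>M. ?N (X m - x) \<le> r / 2" using tail[of "r / 2"] by auto
      then have "norm (?N (X m - x) - 0) < r" if "M \<le> m" for m
      proof -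
        have "\<bar>?N (X m - x)\<bar> = ?N (X m - x)" using nonneg[OF diff[OF X xX]] by (rule abs_of_nonneg)
        moreover have "?N (X m - x) \<le> r / 2"
          using \<open>\<forall>m\<ge>M. ?N (X m - x) \<le> r / 2\<close> that by blast
        ultimately show ?thesis using \<open>0 < r\<close> by simp
      qed
      then show "\<exists>M. \<forall>m\<ge>M. norm (?N (X m - x) - 0) < r" by blast
    qed
    with xX show ?thesis by blast
  qed
  show ?thesis
    by unfold_locales (fact sub nonneg zero_iff scl_eq add(2) compl)+
qed

end

theory Submission
  imports Defs
begin

text \<open>
  The differences \<open>x\<^sub>n = e\<^sub>2\<^sub>n\<^sub>+\<^sub>1 - e\<^sub>2\<^sub>n\<close> are weakly null: a signed sum of \<open>p\<close> of them has norm at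
  most \<open>2 (w\<^sub>0 + \<dots> + w\<^sub>2\<^sub>p\<^sub>-\<^sub>1)\<close>, which is \<open>o(p)\<close>.  So \<open>D = {0, x\<^sub>0, x\<^sub>1, \<dots>}\<close> is weakly compact, and already no
  weakly compact operator \<open>V\<close> of any norm is within \<open>1/4\<close> of the identity on \<open>D\<close>.  Indeed, a sparse
  subsequence of \<open>(V x\<^sub>n)\<close> is almost diagonal with respect to the coordinates \<open>2n+1\<close>.  Its partial sums
  divided by \<open>2 (w\<^sub>0 + \<dots> + w\<^sub>2\<^sub>p\<^sub>-\<^sub>1)\<close> are images of vectors of the unit ball.  As \<open>\<Sum> w\<^sub>j = \<infinity>\<close>, these
  coordinates tend to \<open>0\<close> along the normalised sums, whereas the functional weighting them by
  \<open>w\<^sub>0, w\<^sub>1, \<dots>\<close> stays bounded away from \<open>0\<close>; so the images have no weak cluster point.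
\<close>

subsection \<open>The weak topology\<close>

context banach_space_on
begin

lemma bounded_functional_sum:
  assumes f: "bounded_functional s E N f" and x: "\<And>i. i \<in> A \<Longrightarrow> x i \<in> E"
  shows "f (\<Sum>i\<in>A. s (c i) (x i)) = (\<Sum>i\<in>A. c i * f (x i))"
proof -
  have add: "f (u + v) = f u + f v" if "u \<in> E" "v \<in> E" for u v
    using f that by (simp add: bounded_functional_def)
  have scl: "f (s a u) = a * f u" if "u \<in> E" for a u
    using f that by (simp add: bounded_functional_def)
  have "0 \<in> E" by (rule subspace_0[OF subspace_carrier])
  then have zero: "f 0 = 0"
    using scl[of 0 0] by simp
  show ?thesis
    using x
  proof (induction A rule: infinite_finite_induct)
    case (insert i A)
    have "(\<Sum>i\<in>A. s (c i) (x i)) \<in> E"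
      by (intro subspace_sum[OF subspace_carrier] subspace_scale[OF subspace_carrier] insert.prems) simp
    moreover have "s (c i) (x i) \<in> E"
      by (intro subspace_scale[OF subspace_carrier] insert.prems) simp
    ultimately show ?case
      using insert by (simp add: add scl)
  qed (simp_all add: zero)
qed

lemma bounded_functional_comp:
  assumes f: "bounded_functional s E N f" and V: "bounded_operator s E N V"
  shows "bounded_functional s E N (f \<circ> V)"
proof -
  obtain K L where K: "\<And>x. x \<in> E \<Longrightarrow> norm (f x) \<le> K * N x"
    and L: "\<And>x. x \<in> E \<Longrightarrow> N (V x) \<le> L * N x"
    using f V unfolding bounded_functional_def bounded_operator_def by blast
  have VE: "V x \<in> E" if "x \<in> E" for x
    using V that by (simp add: bounded_operator_def)
  have "norm (f (V x)) \<le> \<bar>K\<bar> * L * N x" if x: "x \<in> E" for x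
  proof -
    have "norm (f (V x)) \<le> K * N (V x)" by (rule K[OF VE[OF x]])
    also have "\<dots> \<le> \<bar>K\<bar> * N (V x)"
      by (intro mult_right_mono norm_nonneg VE x) simp
    also have "\<dots> \<le> \<bar>K\<bar> * (L * N x)"
      by (intro mult_left_mono L x) simp
    finally show ?thesis by simp
  qed
  then show ?thesis
    using f V unfolding bounded_functional_def bounded_operator_def by auto
qed

text \<open>The zero functional together with \<open>UNIV\<close> makes \<open>E\<close> itself a
  subbasic set.\<close>

lemma topspace_weak: "topspace (weak_topology s E N) = E"
proof -
  have "bounded_functional s E N (\<lambda>_. 0)"
    by (auto simp: bounded_functional_def intro: exI[of _ 0])
  then have "E \<in> {{x \<in> E. f x \<in> U} | f U. bounded_functional s E N f \<and> open U}"
    by (intro CollectI exI[of _ "\<lambda>_. 0"] exI[of _ UNIV]) simp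
  then show ?thesis
    unfolding weak_topology_def topology_generated_by_topspace by auto
qed

lemma openin_weak:
  assumes "bounded_functional s E N f" "open U"
  shows "openin (weak_topology s E N) {x \<in> E. f x \<in> U}"
  unfolding weak_topology_def using assms by (intro topology_generated_by_Basis) blast

text \<open>The property of eventually containing the sequence once \<open>l\<close> is a member
  passes to unions and finite intersections; convergence under every functional gives it on the
  subbasis.\<close>

lemma limitin_weakI:
  assumes l: "l \<in> E" and x: "\<And>n. x n \<in> E"
    and lim: "\<And>f. bounded_functional s E N f \<Longrightarrow> (\<lambda>n. f (x n)) \<longlonglongrightarrow> f l"
  shows "limitin (weak_topology s E N) x l sequentially"
proof -
  have "eventually (\<lambda>n. x n \<in> W) sequentially"
    if "generate_topology_on {{x \<in> E. f x \<in> U} | f U. bounded_functional s E N f \<and> open U} W"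
      and "l \<in> W" for W
    using that
  proof (induction rule: generate_topology_on.induct)
    case (UN K)
    then obtain k where k: "k \<in> K" "l \<in> k" by blast
    then show ?case
      using UN.IH[OF k] by (auto elim!: eventually_mono)
  next
    case (Basis S)
    then obtain f U where S: "S = {x \<in> E. f x \<in> U}" "bounded_functional s E N f" "open U"
      by blast
    then show ?case
      using topological_tendstoD[OF lim[OF S(2)] S(3)] Basis x by simp
  qed (auto simp: eventually_conj_iff)
  then show ?thesis
    unfolding limitin_def topspace_weak using l
    by (auto simp: weak_topology_def openin_topology_generated_by_iff)
qed

text \<open>If every point of \<open>K\<close> had an open neighbourhood containing
  \<open>y p\<close> for only finitely many \<open>p\<close>, a finite subcover would make the index
  set finite. Infinite index sets in the conclusion avoid extracting a weakly convergent
  subsequence.\<close>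

lemma weakly_compact_cluster_point:
  assumes K: "compactin (weak_topology s E N) K" and y: "\<And>p::nat. y p \<in> K"
  obtains z where "z \<in> E"
    and "\<And>f U. bounded_functional s E N f \<Longrightarrow> open U \<Longrightarrow> f z \<in> U \<Longrightarrow> infinite {p. f (y p) \<in> U}"
proof -
  have KE: "K \<subseteq> E"
    using compactin_subset_topspace[OF K] by (simp add: topspace_weak)
  define \<U> where "\<U> = {W. openin (weak_topology s E N) W \<and> finite {p. y p \<in> W}}"
  have "\<not> K \<subseteq> \<Union>\<U>"
  proof
    assume "K \<subseteq> \<Union>\<U>"
    then obtain \<F> where \<F>: "finite \<F>" "\<F> \<subseteq> \<U>" "K \<subseteq> \<Union>\<F>"
      using compactinD[OF K, of \<U>] by (auto simp: \<U>_def)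
    have "finite (\<Union>W\<in>\<F>. {p. y p \<in> W})"
      using \<F> by (auto simp: \<U>_def)
    moreover have "(\<Union>W\<in>\<F>. {p. y p \<in> W}) = UNIV"
      using \<F>(3) y by blast
    ultimately show False by simp
  qed
  then obtain z where z: "z \<in> K" "z \<notin> \<Union>\<U>" by blast
  show ?thesis
  proof (rule that)
    show "z \<in> E" using z KE by blast
    fix f U assume f: "bounded_functional s E N f" "open U" "f z \<in> U"
    have "{x \<in> E. f x \<in> U} \<notin> \<U>"
      using z f KE by blast
    then show "infinite {p. f (y p) \<in> U}"
      using openin_weak[OF f(1,2)] y KE
      by (auto simp: \<U>_def elim!: finite_subset[rotated])
  qed
qed

text \<open>The scalars are Hausdorff, so a scalar sequence tending to \<open>0\<close> has no other
  cluster point.\<close>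

lemma cluster_point_eq_0:
  assumes f: "bounded_functional s E N f" and lim: "(\<lambda>p. f (y p)) \<longlonglongrightarrow> 0"
    and cl: "\<And>U. open U \<Longrightarrow> f z \<in> U \<Longrightarrow> infinite {p::nat. f (y p) \<in> U}"
  shows "f z = 0"
proof (rule ccontr)
  assume nz: "f z \<noteq> 0"
  obtain A B where AB: "open A" "open B" "f z \<in> A" "0 \<in> B" "A \<inter> B = {}"
    using hausdorff[OF nz] by blast
  have "eventually (\<lambda>p. f (y p) \<in> B) sequentially"
    using topological_tendstoD[OF lim AB(2,4)] .
  then have "finite {p. f (y p) \<notin> B}"
    by (simp add: eventually_cofinite flip: cofinite_eq_sequentially)
  moreover have "{p. f (y p) \<in> A} \<subseteq> {p. f (y p) \<notin> B}"
    using AB(5) by blast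
  ultimately show False
    using cl[OF AB(1,3)] finite_subset by blast
qed

end

subsection \<open>Sequences and sums\<close>

text \<open>In contrapositive form this yields infinitely many terms bounded away from
  \<open>0\<close>, the start of two later arguments by contradiction.\<close>

lemma tendsto_zero_if_finite:
  fixes f :: "nat \<Rightarrow> 'a::real_normed_vector"
  assumes "\<And>e. 0 < e \<Longrightarrow> finite {n. e \<le> norm (f n)}"
  shows "f \<longlonglongrightarrow> 0"
proof (rule tendstoI)
  fix e :: real assume "0 < e"
  then show "eventually (\<lambda>n. dist (f n) 0 < e) sequentially"
    using assms[of e] by (simp add: eventually_cofinite not_less flip: cofinite_eq_sequentially)
qed

text \<open>The maximum \<open>b\<close> of a finite set is at least the number of its other
  elements, so \<open>w b\<close> is at most the next initial weight.\<close>

lemma sum_le_sum_initial: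
  fixes w :: "nat \<Rightarrow> real"
  assumes w: "decseq w" and A: "finite A"
  shows "sum w A \<le> (\<Sum>j<card A. w j)"
  using A
proof (induction A rule: finite_linorder_max_induct)
  case (insert b A)
  have "A \<subseteq> {..<b}" using insert by auto
  from card_mono[OF _ this] have "card A \<le> b" by simp
  then have "w b \<le> w (card A)" using w by (simp add: decseq_def)
  moreover have "b \<notin> A" using insert by auto
  ultimately show ?case using insert by simp
qed simp

text \<open>Each of \<open>w (2 * p)\<close> and \<open>w (Suc (2 * p))\<close> is at most
  \<open>w p\<close>. This later compares the \<open>2 * p\<close> weights in the norm bound with
  the \<open>p\<close> weights seen by a functional.\<close>

lemma sum_double_le:
  fixes w :: "nat \<Rightarrow> real"
  assumes "decseq w"
  shows "(\<Sum>j<2 * p. w j) \<le> 2 * (\<Sum>j<p. w j)"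
proof (induction p)
  case (Suc p)
  have "w (2 * p) \<le> w p" "w (Suc (2 * p)) \<le> w p"
    using assms by (simp_all add: decseq_def)
  with Suc show ?case by simp
qed simp

text \<open>Choose \<open>r j\<close> after its predecessors: the entries pairing \<open>b\<close>
  with the finitely many earlier indices are all below \<open>(1/4)^j\<close> once \<open>b\<close>
  is large. The product bound makes rows and columns summable off the diagonal.\<close>

lemma off_diagonal_subsequence:
  fixes m :: "nat \<Rightarrow> nat \<Rightarrow> 'a::real_normed_vector"
  assumes row: "\<And>a. (\<lambda>b. m a b) \<longlonglongrightarrow> 0" and col: "\<And>b. (\<lambda>a. m a b) \<longlonglongrightarrow> 0"
  obtains r :: "nat \<Rightarrow> nat" where "strict_mono r"
    and "\<And>i j. i \<noteq> j \<Longrightarrow> norm (m (r i) (r j)) \<le> (1/2)^i * (1/2)^j"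
proof -
  define P where "P f j b \<longleftrightarrow> (\<forall>i<j. f i < b \<and> norm (m (f i) b) < (1/4)^j \<and> norm (m b (f i)) < (1/4)^j)"
    for f :: "nat \<Rightarrow> nat" and j b :: nat
  have "\<exists>r. \<forall>j. P r j (r j)"
  proof (rule dependent_wellorder_choice)
    show "P f j b = P g j b" if "\<And>i. i < j \<Longrightarrow> f i = g i" for b f g j
      using that by (simp add: P_def)
    fix j :: nat and f :: "nat \<Rightarrow> nat"
    have "eventually (\<lambda>b. f i < b \<and> norm (m (f i) b) < (1/4)^j \<and> norm (m b (f i)) < (1/4)^j) sequentially" for i
      using tendstoD[OF row, of "(1/4)^j" "f i"] tendstoD[OF col, of "(1/4)^j" "f i"]
        eventually_gt_at_top[of "f i"]
      by (auto simp: eventually_conj_iff)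
    then have "eventually (P f j) sequentially"
      unfolding P_def[abs_def] by (intro eventually_ball_finite[of "{..<j}", simplified lessThan_iff Ball_def]) auto
    then show "\<exists>b. P f j b"
      by (rule eventually_happens'[rotated]) simp
  qed
  then obtain r where r: "\<And>i j. i < j \<Longrightarrow> r i < r j"
    "\<And>i j. i < j \<Longrightarrow> norm (m (r i) (r j)) < (1/4)^j" "\<And>i j. i < j \<Longrightarrow> norm (m (r j) (r i)) < (1/4)^j"
    unfolding P_def by blast
  \<comment> \<open>Weakening one of the two factors \<open>(1/2)^j\<close> of
    \<open>(1/4)^j\<close> gives a bound symmetric in \<open>i\<close> and \<open>j\<close>.\<close>
  have pow: "(1/4::real)^j \<le> (1/2)^i * (1/2)^j" if "i < j" for i j :: nat
  proof -
    have "(1/4::real)^j = (1/2)^j * (1/2)^j" by (simp flip: power_mult_distrib)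
    also have "\<dots> \<le> (1/2)^i * (1/2)^j"
      using that by (intro mult_right_mono power_decreasing) auto
    finally show ?thesis .
  qed
  show ?thesis
  proof (rule that)
    show "strict_mono r" using r(1) by (simp add: strict_mono_def)
    fix i j :: nat assume "i \<noteq> j"
    then consider "i < j" | "j < i" by linarith
    then show "norm (m (r i) (r j)) \<le> (1/2)^i * (1/2)^j"
    proof cases
      case 1
      then show ?thesis using r(2)[OF 1] pow[OF 1] by linarith
    next
      case 2
      then show ?thesis using r(3)[OF 2] pow[OF 2] by (simp add: mult.commute)
    qed
  qed
qed

subsection \<open>Weakly null differences of unit vectors\<close>

text \<open>The blocks \<open>{2 * n, 2 * n + 1}\<close> are disjoint and the two entries in each
  cancel, so interval sums see only incomplete blocks.\<close>

definition unit_diff :: "nat \<Rightarrow> nat \<Rightarrow> 'k::real_normed_field" where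
  "unit_diff n = (\<lambda>k. of_bool (k = Suc (2 * n)) - of_bool (k = 2 * n))"

lemma sum_unit_diff:
  assumes "finite A"
  shows "(\<Sum>n\<in>A. seq_scale (c n) (unit_diff n)) k =
    (if k div 2 \<in> A then (if odd k then c (k div 2) else - c (k div 2)) else 0)"
proof -
  have "(\<Sum>n\<in>A. seq_scale (c n) (unit_diff n)) k = (\<Sum>n\<in>A. c n * unit_diff n k)"
    by (induction A rule: infinite_finite_induct) (simp_all add: seq_scale_def)
  also have "\<dots> = (\<Sum>n\<in>A. if n = k div 2 then (if odd k then c n else - c n) else 0)"
    by (intro sum.cong refl) (auto simp: unit_diff_def elim!: evenE oddE)
  finally show ?thesis using assms by (simp add: sum.delta)
qed

text \<open>By cancellation a partial sum of \<open>y\<close> has modulus at most 1, hence an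
  interval sum at most 2. At most \<open>2 * card A\<close> disjoint intervals meet the support, and
  for decreasing \<open>w\<close> their weights sum to at most the first \<open>2 * card A\<close>
  weights.\<close>

lemma AH_norm_sum_unit_diff:
  fixes w :: "nat \<Rightarrow> real" and c :: "nat \<Rightarrow> 'k::real_normed_field"
  assumes pos: "\<And>j. 0 < w j" and dec: "decseq w"
    and A: "finite A" and c: "\<And>n. n \<in> A \<Longrightarrow> norm (c n) \<le> 1"
  defines "y \<equiv> \<Sum>n\<in>A. seq_scale (c n) (unit_diff n)"
  shows "y \<in> AH_space w" "AH_norm w y \<le> 2 * (\<Sum>j<2 * card A. w j)"
proof -
  have y: "y k = (if k div 2 \<in> A then (if odd k then c (k div 2) else - c (k div 2)) else 0)" for k
    unfolding y_def by (rule sum_unit_diff[OF A])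
  define S where "S = {k. k div 2 \<in> A}"
  have sub: "S \<subseteq> (\<lambda>n. 2 * n) ` A \<union> (\<lambda>n. Suc (2 * n)) ` A"
  proof
    fix k assume "k \<in> S"
    then show "k \<in> (\<lambda>n. 2 * n) ` A \<union> (\<lambda>n. Suc (2 * n)) ` A"
      by (cases "even k") (auto simp: S_def elim!: evenE oddE)
  qed
  have S: "finite S" using A by (intro finite_subset[OF sub]) simp
  have "card S \<le> card ((\<lambda>n. 2 * n) ` A \<union> (\<lambda>n. Suc (2 * n)) ` A)"
    using A by (intro card_mono sub) simp
  also have "\<dots> \<le> card A + card A"
    using card_Un_le card_image_le[OF A] by (meson add_mono order_trans)
  finally have cardS: "card S \<le> 2 * card A" by simp
  \<comment> \<open>For even \<open>m\<close> all blocks are complete; for odd \<open>m\<close> only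
    the first entry of the block \<open>m div 2\<close> is left over.\<close>
  have partial: "(\<Sum>k<m. y k) = (if odd m \<and> m div 2 \<in> A then - c (m div 2) else 0)" for m
    by (induction m) (auto simp: y elim!: evenE oddE)
  then have norm_partial: "norm (\<Sum>k<m. y k) \<le> 1" for m
    using c by simp
  have interval: "norm (\<Sum>k\<in>{a..b}. y k) \<le> 2" if "a \<le> b" for a b
  proof -
    have "(\<Sum>k\<in>{a..b}. y k) = (\<Sum>k<Suc b. y k) - (\<Sum>k<a. y k)"
      using that sum_diff_nat_ivl[of 0 a "Suc b" y]
      by (simp add: atLeastLessThanSuc_atLeastAtMost lessThan_Suc_atMost atLeast0LessThan atLeast0AtMost
          del: sum.lessThan_Suc)
    then show ?thesis
      using norm_triangle_ineq4[of "\<Sum>k<Suc b. y k" "\<Sum>k<a. y k"] norm_partial[of "Suc b"] norm_partial[of a]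
      by simp
  qed
  have "(\<Sum>j<n. w j * norm (\<Sum>k\<in>{a j..b j}. y k)) \<le> 2 * (\<Sum>j<2 * card A. w j)"
    if ab: "\<forall>j<n. a j \<le> b j" "\<forall>j. Suc j < n \<longrightarrow> b j < a (Suc j)" for n a b
  proof -
    have sep: "b i < a j" if "i < j" "j < n" for i j
      using that
    proof (induction j)
      case (Suc j)
      show ?case
      proof (cases "i = j")
        case False
        with Suc have "b i < a j" by simp
        also have "a j \<le> b j" using ab Suc by simp
        also have "b j < a (Suc j)" using ab Suc by simp
        finally show ?thesis .
      qed (use ab Suc in simp)
    qed simp
    \<comment> \<open>A support point chosen in each interval of \<open>J\<close> determines the
      interval by disjointness, so \<open>J\<close> is no larger than the support.\<close>
    define J where "J = {j. j < n \<and> {a j..b j} \<inter> S \<noteq> {}}"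
    then have "\<forall>j\<in>J. \<exists>k. k \<in> {a j..b j} \<inter> S" by auto
    then obtain g where g: "\<And>j. j \<in> J \<Longrightarrow> g j \<in> {a j..b j} \<inter> S"
      by metis
    have "inj_on g J"
    proof (rule inj_onI, rule ccontr)
      fix i j assume ij: "i \<in> J" "j \<in> J" "g i = g j" "i \<noteq> j"
      then consider "i < j" | "j < i" by linarith
      then show False
        using sep[of i j] sep[of j i] g[OF ij(1)] g[OF ij(2)] ij by cases (auto simp: J_def)
    qed
    moreover have "g ` J \<subseteq> S" using g by blast
    ultimately have cardJ: "card J \<le> 2 * card A"
      using card_inj_on_le[OF _ _ S] cardS by (meson order_trans)
    have J: "finite J" "J \<subseteq> {..<n}" by (auto simp: J_def)
    have "(\<Sum>j<n. w j * norm (\<Sum>k\<in>{a j..b j}. y k)) = (\<Sum>j\<in>J. w j * norm (\<Sum>k\<in>{a j..b j}. y k))"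
    proof (rule sum.mono_neutral_right)
      show "\<forall>j\<in>{..<n} - J. w j * norm (\<Sum>k\<in>{a j..b j}. y k) = 0"
      proof
        fix j assume "j \<in> {..<n} - J"
        then have "(\<Sum>k\<in>{a j..b j}. y k) = 0"
          by (intro sum.neutral) (auto simp: J_def S_def y)
        then show "w j * norm (\<Sum>k\<in>{a j..b j}. y k) = 0" by simp
      qed
    qed (use J in auto)
    also have "\<dots> \<le> (\<Sum>j\<in>J. w j * 2)"
      using ab J by (intro sum_mono mult_left_mono interval less_imp_le[OF pos]) auto
    also have "\<dots> = 2 * sum w J" unfolding mult.commute[of 2 "sum w J"] sum_distrib_right ..
    also have "\<dots> \<le> 2 * (\<Sum>j<card J. w j)"
      using sum_le_sum_initial[OF dec J(1)] by simp
    also have "\<dots> \<le> 2 * (\<Sum>j<2 * card A. w j)"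
      using cardJ by (intro mult_left_mono sum_mono2) (auto intro: less_imp_le[OF pos])
    finally show ?thesis .
  qed
  from AH_normI[of w y, OF this] show "y \<in> AH_space w" "AH_norm w y \<le> 2 * (\<Sum>j<2 * card A. w j)"
    by blast+
qed

text \<open>Otherwise \<open>p\<close> of the differences have values of modulus at least
  \<open>e\<close>. Rotating these values to be positive gives a sum on which \<open>f\<close> is at
  least \<open>p * e\<close>, while its norm is \<open>o(p)\<close> because \<open>w\<close> tends
  to \<open>0\<close>.\<close>

lemma unit_diff_tendsto_0:
  fixes w :: "nat \<Rightarrow> real" and f :: "(nat \<Rightarrow> 'k::{real_normed_field,euclidean_space}) \<Rightarrow> 'k"
  assumes pos: "\<And>j. 0 < w j" and dec: "decseq w" and w0: "w 0 = 1" and lim: "w \<longlonglongrightarrow> 0"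
    and f: "bounded_functional seq_scale (AH_space w) (AH_norm w) f"
  shows "(\<lambda>n. f (unit_diff n)) \<longlonglongrightarrow> 0"
proof (rule tendsto_zero_if_finite, rule ccontr)
  interpret banach_space_on "seq_scale :: 'k \<Rightarrow> _" "AH_space w" "AH_norm w"
    by (rule AH_space_banach[where w = w, OF pos w0])
  have unit: "unit_diff n \<in> AH_space w" for n
    using AH_norm_sum_unit_diff(1)[OF pos dec, of "{n}" "\<lambda>_. 1"] by (simp add: seq_scale_def)
  obtain K where "\<And>x. x \<in> AH_space w \<Longrightarrow> norm (f x) \<le> K * AH_norm w x"
    using f unfolding bounded_functional_def by blast
  \<comment> \<open>\<open>K\<close> might be zero or negative; \<open>max K 1\<close> is a bound by
    which one can divide.\<close>
  then have "norm (f x) \<le> max K 1 * AH_norm w x" if "x \<in> AH_space w" for x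
    using mult_right_mono[OF max.cobounded1[of K 1] norm_nonneg[OF that]] that by (meson order_trans)
  moreover define L where "L = max K 1"
  ultimately have L: "L > 0" "\<And>x. x \<in> AH_space w \<Longrightarrow> norm (f x) \<le> L * AH_norm w x"
    by auto
  fix e :: real assume e: "0 < e" and inf: "infinite {n. e \<le> norm (f (unit_diff n))}"
  \<comment> \<open>With this \<open>d\<close> the weights beyond \<open>M\<close> contribute
    \<open>L * (2 * (d * (2 * p)))\<close>, exactly \<open>p * e / 2\<close>.\<close>
  define d where "d = e / (8 * L)"
  have "0 < d" using e L by (simp add: d_def)
  then obtain M where M: "\<And>j. M \<le> j \<Longrightarrow> w j \<le> d"
    using order_tendstoD(2)[OF lim, of d] by (auto simp: eventually_sequentially intro: less_imp_le)
  have sum_w: "(\<Sum>j<m. w j) \<le> (\<Sum>j<M. w j) + d * m" for m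
  proof -
    have "(\<Sum>j<m. w j) \<le> (\<Sum>j<m. (if j < M then w j else 0) + d)"
      using M \<open>0 < d\<close> by (intro sum_mono) (auto simp: not_less)
    also have "\<dots> = (\<Sum>j\<in>{..<m} \<inter> {..<M}. w j) + d * m"
      by (simp add: sum.distrib sum.inter_restrict lessThan_def mult.commute)
    also have "\<dots> \<le> (\<Sum>j<M. w j) + d * m"
      by (intro add_right_mono sum_mono2) (auto intro: less_imp_le[OF pos])
    finally show ?thesis .
  qed
  \<comment> \<open>For such \<open>p\<close> the first \<open>M\<close> weights cannot supply the
    other half of \<open>p * e\<close>.\<close>
  obtain p :: nat where p: "8 * L * (\<Sum>j<M. w j) / e < p"
    using reals_Archimedean2 by blast
  obtain A where A: "finite A" "card A = p" "A \<subseteq> {n. e \<le> norm (f (unit_diff n))}"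
    using infinite_arbitrarily_large[OF inf] by blast
  \<comment> \<open>Unimodular where \<open>f (unit_diff n)\<close> is nonzero; elsewhere division
    by zero gives \<open>c n = 0\<close>, which still meets both requirements.\<close>
  define c where "c n = of_real (norm (f (unit_diff n))) / f (unit_diff n)" for n
  have c: "norm (c n) \<le> 1" "c n * f (unit_diff n) = of_real (norm (f (unit_diff n)))" for n
    by (auto simp: c_def norm_divide)
  let ?y = "\<Sum>n\<in>A. seq_scale (c n) (unit_diff n)"
  have "f ?y = of_real (\<Sum>n\<in>A. norm (f (unit_diff n)))"
    using bounded_functional_sum[OF f, of A unit_diff c, OF unit] by (simp add: c)
  then have "norm (f ?y) = (\<Sum>n\<in>A. norm (f (unit_diff n)))"
    by (simp add: sum_nonneg del: of_real_sum)
  also have "\<dots> \<ge> (\<Sum>n\<in>A. e)"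
    using A by (intro sum_mono) auto
  finally have "p * e \<le> norm (f ?y)" using A by simp
  also have "\<dots> \<le> L * AH_norm w ?y"
    by (intro L AH_norm_sum_unit_diff[OF pos dec A(1)] c)
  also have "\<dots> \<le> L * (2 * (\<Sum>j<2 * p. w j))"
    using AH_norm_sum_unit_diff(2)[OF pos dec A(1), of c] c L A by (intro mult_left_mono) auto
  also have "\<dots> \<le> L * (2 * ((\<Sum>j<M. w j) + d * (2 * p)))"
    using sum_w[of "2 * p"] L by (intro mult_left_mono) auto
  also have "\<dots> = 2 * L * (\<Sum>j<M. w j) + p * e / 2"
    using L by (simp add: d_def field_simps)
  finally have "p * e \<le> 4 * L * (\<Sum>j<M. w j)" by simp
  moreover have "8 * L * (\<Sum>j<M. w j) < p * e"
    using p e by (simp add: field_simps)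
  moreover have "0 \<le> L * (\<Sum>j<M. w j)"
    using L pos by (intro mult_nonneg_nonneg sum_nonneg) (auto intro: less_imp_le)
  ultimately show False by linarith
qed

subsection \<open>Functionals given by weighted coordinates\<close>

text \<open>The one-point intervals \<open>{r j}\<close> are admissible in the norm, so every
  partial sum is at most \<open>AH_norm w x\<close>.\<close>

lemma AH_weighted_coords:
  fixes w :: "nat \<Rightarrow> real" and x :: "nat \<Rightarrow> 'k::real_normed_field"
  assumes pos: "\<And>j. 0 < w j" and x: "x \<in> AH_space w" and r: "strict_mono r"
  shows "summable (\<lambda>j. w j * norm (x (r j)))" "(\<Sum>j. w j * norm (x (r j))) \<le> AH_norm w x"
proof -
  have le: "(\<Sum>j<n. w j * norm (x (r j))) \<le> AH_norm w x" for n
    using AH_sum_le[OF x, of n r r] strict_monoD[OF r] by simp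
  show "summable (\<lambda>j. w j * norm (x (r j)))"
    using le pos by (intro summableI_nonneg_bounded) (simp_all add: less_imp_le)
  then show "(\<Sum>j. w j * norm (x (r j))) \<le> AH_norm w x"
    using le by (rule suminf_le_const)
qed

text \<open>If infinitely many entries had modulus at least \<open>e\<close>, enumerating them
  increasingly would make \<open>\<Sum> w j * e\<close> converge.\<close>

lemma AH_space_tendsto_0:
  fixes w :: "nat \<Rightarrow> real" and x :: "nat \<Rightarrow> 'k::real_normed_field"
  assumes pos: "\<And>j. 0 < w j" and div: "\<not> summable w" and x: "x \<in> AH_space w"
  shows "x \<longlonglongrightarrow> 0"
proof (rule tendsto_zero_if_finite, rule ccontr)
  fix e :: real assume e: "0 < e" and inf: "infinite {n. e \<le> norm (x n)}"
  obtain r :: "nat \<Rightarrow> nat" where r: "strict_mono r" and ge: "\<And>j. e \<le> norm (x (r j))"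
    using infinite_enumerate[OF inf] by auto
  have "summable (\<lambda>j. w j * e)"
  proof (rule summable_comparison_test'[OF AH_weighted_coords(1)[OF pos x r]])
    show "norm (w j * e) \<le> w j * norm (x (r j))" if "0 \<le> j" for j
      using e ge[of j] pos[of j] by (simp add: abs_mult)
  qed
  from summable_mult2[OF this, of "inverse e"] show False
    using div e by (simp add: mult.assoc)
qed

text \<open>The series converges absolutely with sum of moduli at most the norm, so 1 serves as the
  bound.\<close>

lemma bounded_functional_weighted_coords:
  fixes w :: "nat \<Rightarrow> real"
  assumes pos: "\<And>j. 0 < w j" and r: "strict_mono r"
  shows "bounded_functional (seq_scale :: 'k::{real_normed_field,euclidean_space} \<Rightarrow> _)
    (AH_space w) (AH_norm w) (\<lambda>x. \<Sum>j. of_real (w j) * x (r j))"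
proof -
  have abs_summable: "summable (\<lambda>j. norm (of_real (w j) * x (r j)))"
    and le: "(\<Sum>j. norm (of_real (w j) * x (r j))) \<le> AH_norm w x"
    if "x \<in> AH_space w" for x :: "nat \<Rightarrow> 'k"
    using AH_weighted_coords[OF pos that r] pos by (simp_all add: norm_mult less_imp_le)
  note summable = summable_norm_cancel[OF abs_summable]
  show ?thesis
    unfolding bounded_functional_def
  proof (intro conjI ballI allI exI[of _ 1])
    fix x y :: "nat \<Rightarrow> 'k" assume "x \<in> AH_space w" "y \<in> AH_space w"
    from suminf_add[OF this[THEN summable]]
    show "(\<Sum>j. of_real (w j) * (x + y) (r j)) =
        (\<Sum>j. of_real (w j) * x (r j)) + (\<Sum>j. of_real (w j) * y (r j))"
      by (simp add: distrib_left)
  next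
    fix c and x :: "nat \<Rightarrow> 'k" assume "x \<in> AH_space w"
    from suminf_mult[OF this[THEN summable], of c]
    show "(\<Sum>j. of_real (w j) * seq_scale c x (r j)) = c * (\<Sum>j. of_real (w j) * x (r j))"
      by (simp add: seq_scale_def mult.left_commute)
  next
    fix x :: "nat \<Rightarrow> 'k" assume x: "x \<in> AH_space w"
    show "norm (\<Sum>j. of_real (w j) * x (r j)) \<le> 1 * AH_norm w x"
      using summable_norm[OF abs_summable[OF x]] le[OF x] by simp
  qed
qed

lemma bounded_functional_coord:
  assumes "w 0 = 1"
  shows "bounded_functional (seq_scale :: 'k::real_normed_field \<Rightarrow> _) (AH_space w) (AH_norm w) (\<lambda>x. x k)"
  unfolding bounded_functional_def
  using AH_coord_le[where w = w, OF _ assms] by (auto simp: seq_scale_def intro!: exI[of _ 1])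

section \<open>Failure of weakly compact approximation on the differences\<close>

theorem mainTheorem9:
  fixes w :: "nat \<Rightarrow> real"
  assumes "\<And>j. 0 < w j"
    and "decseq w"
    and "w 0 = 1"
    and "w \<longlonglongrightarrow> 0"
    and "\<not> summable w"
  shows "\<not> has_WAP (seq_scale :: 'k::{real_normed_field,euclidean_space} \<Rightarrow> (nat \<Rightarrow> 'k) \<Rightarrow> nat \<Rightarrow> 'k)
           (AH_space w) (AH_norm w)"
proof
  let ?E = "AH_space w :: (nat \<Rightarrow> 'k) set" and ?N = "AH_norm w :: (nat \<Rightarrow> 'k) \<Rightarrow> real"
  let ?s = "seq_scale :: 'k \<Rightarrow> _"
  let ?x = "unit_diff :: nat \<Rightarrow> nat \<Rightarrow> 'k"
  note pos = assms(1) and dec = assms(2) and w0 = assms(3) and w_lim = assms(4) and div = assms(5)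
  interpret banach_space_on ?s ?E ?N
    by (rule AH_space_banach[where w = w, OF pos w0])
  note coord_functional = bounded_functional_coord[where w = w and 'k = 'k, OF w0]
  have unit: "?x n \<in> ?E" for n
    using AH_norm_sum_unit_diff(1)[where w = w, OF pos dec, of "{n}" "\<lambda>_. 1"]
    by (simp add: seq_scale_def)
  have functional_0: "f 0 = 0" if "bounded_functional ?s ?E ?N f" for f
    using bounded_functional_sum[OF that, of "{}"] by simp
  have "0 \<in> ?E" by (rule subspace_0[OF subspace_carrier])
  have "limitin (weak_topology ?s ?E ?N) ?x 0 sequentially"
  proof (rule limitin_weakI[OF \<open>0 \<in> ?E\<close> unit])
    fix f assume f: "bounded_functional ?s ?E ?N f"
    show "(\<lambda>n. f (?x n)) \<longlonglongrightarrow> f 0"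
      using unit_diff_tendsto_0[where w = w, OF pos dec w0 w_lim f] functional_0[OF f] by (simp only:)
  qed
  then have D: "compactin (weak_topology ?s ?E ?N) (insert 0 (range ?x))"
    using unit by (intro compactin_sequence_with_limit) (auto simp: topspace_weak)
  assume "has_WAP ?s ?E ?N"
  with D obtain V where V: "weakly_compact_operator ?s ?E ?N V"
    and sup: "(SUP x\<in>insert 0 (range ?x). ereal (?N (x - V x))) < ereal (1/4)"
    unfolding has_WAP_def by (metis zero_less_divide_1_iff zero_less_numeral)
  have Vop: "bounded_operator ?s ?E ?N V"
    and K: "compactin (weak_topology ?s ?E ?N) (weak_topology ?s ?E ?N closure_of (V ` {x \<in> ?E. ?N x \<le> 1}))"
    using V by (simp_all add: weakly_compact_operator_def)
  have VE: "V x \<in> ?E" if "x \<in> ?E" for x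
    using Vop that by (simp add: bounded_operator_def)
  have close: "?N (?x n - V (?x n)) < 1/4" for n
  proof -
    have "ereal (?N (?x n - V (?x n))) \<le> (SUP x\<in>insert 0 (range ?x). ereal (?N (x - V x)))"
      by (rule SUP_upper) simp
    from order_le_less_trans[OF this sup] show ?thesis by simp
  qed

  \<comment> \<open>The almost diagonal matrix of \<open>V\<close>\<close>
  define m where "m a b = V (?x a) (Suc (2 * b))" for a b
  \<comment> \<open>Coordinate \<open>Suc (2 * a)\<close> is where \<open>?x a\<close> has the entry
    1, and coordinates are bounded by the norm.\<close>
  have diag: "norm (m a a - 1) < 1/4" for a
  proof -
    have "norm ((?x a - V (?x a)) (Suc (2 * a))) \<le> ?N (?x a - V (?x a))"
      by (intro AH_coord_le[where w = w, OF _ w0] subspace_diff[OF subspace_carrier] unit VE)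
    moreover have "(?x a - V (?x a)) (Suc (2 * a)) = 1 - m a a"
      by (simp add: m_def unit_diff_def)
    ultimately show ?thesis using close[of a] by (simp add: norm_minus_commute)
  qed
  \<comment> \<open>Rows are coordinates of one vector of the space, which vanish at infinity since
    the weights diverge.\<close>
  have row: "(\<lambda>b. m a b) \<longlonglongrightarrow> 0" for a
    unfolding m_def
    using LIMSEQ_subseq_LIMSEQ[OF AH_space_tendsto_0[where w = w, OF pos div VE[OF unit]],
        of "\<lambda>b. Suc (2 * b)" a]
    by (simp add: strict_mono_def o_def)
  \<comment> \<open>Columns are values of the bounded functional "coordinate after \<open>V\<close>"
    on the weakly null sequence.\<close>
  have col: "(\<lambda>a. m a b) \<longlonglongrightarrow> 0" for b
    unfolding m_def
    using unit_diff_tendsto_0[where w = w, OF pos dec w0 w_lim bounded_functional_comp[OF coord_functional Vop]]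
    by simp
  obtain r where r: "strict_mono r"
    and off: "\<And>i j. i \<noteq> j \<Longrightarrow> norm (m (r i) (r j)) \<le> (1/2)^i * (1/2)^j"
    using off_diagonal_subsequence[OF row col] by blast
  define \<phi> where "\<phi> x = (\<Sum>j. of_real (w j) * x (Suc (2 * r j)))" for x :: "nat \<Rightarrow> 'k"
  have \<phi>: "bounded_functional ?s ?E ?N \<phi>"
    unfolding \<phi>_def[abs_def]
    by (rule bounded_functional_weighted_coords[where w = w, OF pos])
      (use r in \<open>auto simp: strict_mono_def\<close>)
  have w_le_1: "w j \<le> 1" for j
    using dec w0 by (metis decseq_def zero_le)
  \<comment> \<open>The series for \<open>\<phi>\<close> is compared with \<open>w i\<close> term by
    term: the diagonal term is off by at most \<open>w i / 4\<close>, and the rest is dominated by a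
    geometric series of sum \<open>2 * (1/2)^i\<close>.\<close>
  have \<phi>_V: "norm (\<phi> (V (?x (r i))) - of_real (w i)) \<le> 2 * (1/2)^i + w i / 4" for i
  proof -
    have "summable (\<lambda>j. w j * norm (V (?x (r i)) (Suc (2 * r j))))"
      using r by (intro AH_weighted_coords(1)[OF pos VE[OF unit]]) (auto simp: strict_mono_def)
    then have "summable (\<lambda>j. of_real (w j) * m (r i) (r j))"
      unfolding m_def using pos
      by (intro summable_norm_cancel[where f = "\<lambda>j. of_real (w j) * V (?x (r i)) (Suc (2 * r j))"])
        (simp add: norm_mult less_imp_le)
    then have "(\<lambda>j. of_real (w j) * m (r i) (r j)) sums \<phi> (V (?x (r i)))"
      by (simp add: \<phi>_def m_def summable_sums)
    from sums_diff[OF this sums_single[of i "\<lambda>j. of_real (w j)"]]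
    have S: "(\<lambda>j. of_real (w j) * m (r i) (r j) - (if j = i then of_real (w j) else 0))
      sums (\<phi> (V (?x (r i))) - of_real (w i))" (is "?d sums _") .
    have "(\<lambda>j. (1/2::real)^j) sums 2" using geometric_sums[of "1/2::real"] by simp
    from sums_add[OF sums_mult[OF this, of "(1/2)^i"] sums_single[of i "\<lambda>j. w j / 4"]]
    have T: "(\<lambda>j. (1/2)^i * (1/2)^j + (if j = i then w j / 4 else 0)) sums (2 * (1/2)^i + w i / 4)"
      (is "?g sums _") by (simp add: mult.commute)
    have "norm (?d j) \<le> ?g j" for j
    proof (cases "j = i")
      case True
      have "?d j = of_real (w i) * (m (r i) (r i) - 1)" using True by (simp add: right_diff_distrib)
      then have "norm (?d j) = w i * norm (m (r i) (r i) - 1)"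
        using pos[of i] by (simp add: norm_mult)
      also have "\<dots> \<le> w i * (1/4)"
        using diag[of "r i"] pos[of i] by (intro mult_left_mono) auto
      also have "\<dots> \<le> ?g j" using True by simp
      finally show ?thesis .
    next
      case False
      then have "norm (?d j) = w j * norm (m (r i) (r j))"
        using pos[of j] by (simp add: norm_mult)
      also have "\<dots> \<le> 1 * norm (m (r i) (r j))"
        using w_le_1 by (intro mult_right_mono) auto
      also have "\<dots> \<le> ?g j" using off[of i j] False by simp
      finally show ?thesis .
    qed
    then have "norm (suminf ?d) \<le> suminf ?g"
      using T by (intro norm_suminf_le) (auto simp: sums_iff)
    then show ?thesis using S T by (simp add: sums_iff)
  qed

  \<comment> \<open>Normalised partial sums in the unit ball\<close>
  define \<sigma> where "\<sigma> p = 2 * (\<Sum>j<2 * p. w j)" for p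
  have \<sigma>_nonneg: "0 \<le> \<sigma> p" for p
    unfolding \<sigma>_def using pos by (intro mult_nonneg_nonneg sum_nonneg) (auto intro: less_imp_le)
  have "filterlim (\<lambda>p. \<Sum>j<p. w j) at_top sequentially"
  proof (rule filterlim_at_top[THEN iffD2, rule_format])
    fix Z
    have "\<exists>p. Z \<le> (\<Sum>j<p. w j)"
    proof (rule ccontr)
      assume "\<nexists>p. Z \<le> (\<Sum>j<p. w j)"
      then have "summable w"
        using pos by (intro summableI_nonneg_bounded[of w Z]) (auto simp: less_imp_le not_le)
      with div show False by contradiction
    qed
    then obtain p where p: "Z \<le> (\<Sum>j<p. w j)" by blast
    have "Z \<le> (\<Sum>j<q. w j)" if "p \<le> q" for q
      using p sum_mono2[of "{..<q}" "{..<p}" w] that pos by (force simp: less_imp_le)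
    then show "eventually (\<lambda>p. Z \<le> (\<Sum>j<p. w j)) sequentially"
      unfolding eventually_sequentially by blast
  qed
  from filterlim_compose[OF this filterlim_subseq[of "\<lambda>p. 2 * p"]]
  have "filterlim (\<lambda>p. \<Sum>j<2 * p. w j) at_top sequentially"
    by (simp add: strict_mono_def)
  then have \<sigma>_lim: "filterlim \<sigma> at_top sequentially"
    unfolding \<sigma>_def[abs_def] by (intro filterlim_tendsto_pos_mult_at_top[OF tendsto_const]) auto
  define u where "u p = (\<Sum>i<p. ?s (of_real (inverse (\<sigma> p))) (?x (r i)))" for p
  have u: "u p \<in> ?E" "?N (u p) \<le> 1" for p
  proof -
    let ?A = "r ` {..<p}"
    let ?y = "\<Sum>n\<in>?A. ?s 1 (?x n)"
    have inj: "inj_on r {..<p}"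
      by (rule strict_mono_imp_inj_on[OF r])
    have y: "?y \<in> ?E" "?N ?y \<le> \<sigma> p"
      using AH_norm_sum_unit_diff[where w = w, OF pos dec, of ?A "\<lambda>_. 1"]
      by (simp_all add: \<sigma>_def card_image[OF inj] del: scale_one)
    have "u p = ?s (of_real (inverse (\<sigma> p))) ?y"
      by (simp add: u_def sum.reindex[OF inj] scale_sum_right del: of_real_inverse)
    moreover have "inverse (\<sigma> p) * ?N ?y \<le> inverse (\<sigma> p) * \<sigma> p"
      using y \<sigma>_nonneg by (intro mult_left_mono) auto
    \<comment> \<open>An inequality covers \<open>p = 0\<close>, where \<open>\<sigma> p = 0\<close>
      and the inverse is \<open>0\<close> by convention.\<close>
    moreover have "inverse (\<sigma> p) * \<sigma> p \<le> 1"
      by (cases "\<sigma> p = 0") auto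
    ultimately show "u p \<in> ?E" "?N (u p) \<le> 1"
      using y \<sigma>_nonneg[of p]
      by (simp_all add: norm_scale subspace_scale[OF subspace_carrier] norm_inverse)
  qed
  have uV: "f (V (u p)) = of_real (inverse (\<sigma> p)) * (\<Sum>i<p. f (V (?x (r i))))"
    if "bounded_functional ?s ?E ?N f" for f p
    using bounded_functional_sum[OF bounded_functional_comp[OF that Vop], of "{..<p}" "\<lambda>i. ?x (r i)"] unit
    by (simp add: u_def sum_distrib_left)
  have geo: "(\<Sum>i<p. (1/2::real)^i) \<le> 2" for p
  proof -
    have "(\<Sum>i<p. (1/2::real)^i) = 2 - 2 * (1/2)^p" by (induction p) auto
    then show ?thesis by simp
  qed
  have coord: "(\<lambda>p. V (u p) (Suc (2 * r j))) \<longlonglongrightarrow> 0" for j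
  proof (rule Lim_null_comparison)
    \<comment> \<open>The off-diagonal moduli in a column sum to at most 2, so \<open>B\<close>
      bounds the column sums uniformly in \<open>p\<close>, and division by
      \<open>\<sigma> p\<close> sends them to \<open>0\<close>.\<close>
    define B where "B = 2 + norm (m (r j) (r j))"
    have "norm (\<Sum>i<p. m (r i) (r j)) \<le> B" for p
    proof -
      have "norm (m (r i) (r j)) \<le> (1/2)^i + (if i = j then norm (m (r j) (r j)) else 0)" for i
      proof (cases "i = j")
        case False
        have "norm (m (r i) (r j)) \<le> (1/2)^i * (1/2)^j" by (rule off[OF False])
        also have "\<dots> \<le> (1/2)^i * 1" by (intro mult_left_mono power_le_one) auto
        finally show ?thesis using False by simp
      qed simp
      then have "norm (\<Sum>i<p. m (r i) (r j)) \<le>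
          (\<Sum>i<p. (1/2)^i + (if i = j then norm (m (r j) (r j)) else 0))"
        by (intro sum_norm_le) auto
      also have "\<dots> \<le> B"
        using geo[of p] by (auto simp: sum.distrib B_def intro: order_trans)
      finally show ?thesis .
    qed
    moreover have "norm (V (u p) (Suc (2 * r j))) = norm (\<Sum>i<p. m (r i) (r j)) * inverse (\<sigma> p)" for p
      using \<sigma>_nonneg[of p] uV[OF coord_functional, of p "Suc (2 * r j)"]
      by (simp add: norm_mult norm_inverse m_def)
    ultimately have "norm (V (u p) (Suc (2 * r j))) \<le> B * inverse (\<sigma> p)" for p
      using \<sigma>_nonneg[of p] by (simp add: mult_right_mono)
    then show "eventually (\<lambda>p. norm (V (u p) (Suc (2 * r j))) \<le> B * inverse (\<sigma> p)) sequentially"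
      by simp
    show "(\<lambda>p. B * inverse (\<sigma> p)) \<longlonglongrightarrow> 0"
      by (rule tendsto_mult_right_zero[OF tendsto_inverse_0_at_top[OF \<sigma>_lim]])
  qed
  \<comment> \<open>The errors leave \<open>norm ?T \<ge> 3/4 * ?S - 4\<close>, and
    \<open>?S \<ge> \<sigma> p / 4\<close>. This is at least \<open>\<sigma> p / 8\<close> once
    \<open>\<sigma> p \<ge> 64\<close>.\<close>
  have \<phi>_ge: "eventually (\<lambda>p. 1/8 \<le> norm (\<phi> (V (u p)))) sequentially"
    using filterlim_at_top[THEN iffD1, OF \<sigma>_lim, rule_format, of 64]
  proof eventually_elim
    case (elim p)
    let ?S = "\<Sum>i<p. w i" and ?T = "\<Sum>i<p. \<phi> (V (?x (r i)))"
    have "norm (?T - of_real ?S) = norm (\<Sum>i<p. \<phi> (V (?x (r i))) - of_real (w i))"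
      by (simp add: sum_subtractf)
    also have "\<dots> \<le> (\<Sum>i<p. 2 * (1/2)^i + w i / 4)"
      by (intro sum_norm_le \<phi>_V)
    also have "\<dots> = 2 * (\<Sum>i<p. (1/2)^i) + ?S / 4"
      by (simp add: sum.distrib sum_distrib_left sum_divide_distrib)
    also have "\<dots> \<le> 4 + ?S / 4"
      using geo[of p] by simp
    finally have "norm (?T - of_real ?S) \<le> 4 + ?S / 4" .
    moreover have "norm (of_real ?S :: 'k) \<le> norm ?T + norm (?T - of_real ?S)"
      using norm_triangle_sub[of "of_real ?S :: 'k" ?T] by (simp add: norm_minus_commute)
    moreover have "\<bar>?S\<bar> = ?S" by (intro abs_of_nonneg sum_nonneg less_imp_le pos)
    moreover have "\<sigma> p \<le> 4 * ?S"
      using sum_double_le[OF dec, of p] by (simp add: \<sigma>_def)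
    ultimately have "\<sigma> p / 8 \<le> norm ?T" using elim by (simp del: of_real_sum)
    then show ?case
      using elim by (simp add: uV[OF \<phi>] norm_mult norm_inverse norm_divide field_simps)
  qed

  \<comment> \<open>A weak cluster point of the images\<close>
  have "V (u p) \<in> weak_topology ?s ?E ?N closure_of (V ` {x \<in> ?E. ?N x \<le> 1})" for p
  proof -
    have "V ` {x \<in> ?E. ?N x \<le> 1} \<subseteq> topspace (weak_topology ?s ?E ?N)"
      using VE by (auto simp: topspace_weak)
    from closure_of_subset[OF this] show ?thesis using u by auto
  qed
  from weakly_compact_cluster_point[OF K, of "\<lambda>p. V (u p)", OF this]
  obtain z where "z \<in> ?E" and z: "\<And>f U. bounded_functional ?s ?E ?N f \<Longrightarrow> open U \<Longrightarrow> f z \<in> U \<Longrightarrow>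
      infinite {p. f (V (u p)) \<in> U}" by blast
  \<comment> \<open>All coordinates read by \<open>\<phi>\<close> vanish at \<open>z\<close>, so
    \<open>\<phi> z = 0\<close>; clustering then forces infinitely many values below
    \<open>1/8\<close>, against \<open>\<phi>_ge\<close>.\<close>
  have "z (Suc (2 * r j)) = 0" for j
    using cluster_point_eq_0[of "\<lambda>x. x (Suc (2 * r j))" "\<lambda>p. V (u p)" z, OF coord_functional coord
        z[of "\<lambda>x. x (Suc (2 * r j))", OF coord_functional]] .
  then have "\<phi> z = 0" by (simp add: \<phi>_def)
  then have "infinite {p. \<phi> (V (u p)) \<in> ball 0 (1/8)}"
    by (intro z[OF \<phi>]) auto
  moreover have "finite {p. \<phi> (V (u p)) \<in> ball 0 (1/8)}"
    using \<phi>_ge by (simp add: not_le eventually_cofinite flip: cofinite_eq_sequentially)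
  ultimately show False by contradiction
qed

end
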